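(* Let $\mathbb{X}$ be a reflexive strictly convex Banach space and let $n \in \mathbb{N}$. Let $f, g_1, \ldots, g_n \in \mathbb{X}^{*}$ be such that $g_1, \ldots, g_n$ are linearly independent and $f \notin \mathbb{Z}$, where $\mathbb{Z} = \mathrm{span}\{g_1, \ldots, g_n\}$. Let $\alpha_1, \ldots, \alpha_n \in \mathbb{R}$. Then $\sum_{i=1}^{n} \alpha_i g_i$ is a best approximation to $f$ out of $\mathbb{Z}$ if and only if $$\bigcap_{i=1}^{n} \mathcal{N}(g_i) \cap M_{f-\sum_{i=1}^{n} \alpha_i g_i} = \{\pm x_0\}$$ for some $x_0 \in S_{\mathbb{X}}$.
   Context: All Banach spaces are real; $\mathbb{X}^*$ is the dual space with its usual norm, $S_{\mathbb{X}}$ the unit sphere and $B_{\mathbb{X}}$ the closed unit ball. $\mathbb{X}$ is strictly convex if every element of $S_{\mathbb{X}}$ is an extreme point of $B_{\mathbb{X}}$. For $h\in\mathbb{X}^*$, $\mathcal{N}(h)$ is the kernel of $h$ and $M_h = \{x \in S_{\mathbb{X}} : |h(x)| = \|h\|\}$ is its norm attainment set. An element $y$ of a subspace $\mathbb{V}$ of a Banach space is a best approximation to an element $x$ of that space out of $\mathbb{V}$ if $\|x-y\| = \min\{\|x-z\| : z \in \mathbb{V}\}$. *)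

theory Defs
  imports "HOL-Analysis.Analysis"
begin

text \<open>The dual of a real normed space \<open>'a\<close> is the type \<open>'a \<Rightarrow>\<^sub>L real\<close> with its operator norm.\<close>

text \<open>Surjectivity of the canonical embedding into the bidual (not merely the existence of some
  isomorphism between the space and its bidual).\<close>
definition reflexive_space :: "'a::real_normed_vector itself \<Rightarrow> bool" where
  "reflexive_space _ \<longleftrightarrow>
     (\<forall>\<Phi> :: ('a \<Rightarrow>\<^sub>L real) \<Rightarrow>\<^sub>L real. \<exists>x :: 'a. \<forall>h. blinfun_apply \<Phi> h = blinfun_apply h x)"

definition strictly_convex_space :: "'a::real_normed_vector itself \<Rightarrow> bool" where
  "strictly_convex_space _ \<longleftrightarrow>
     (\<forall>x \<in> sphere (0 :: 'a) 1. x extreme_point_of cball (0 :: 'a) 1)"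

definition functional_kernel :: "('a::real_normed_vector \<Rightarrow>\<^sub>L real) \<Rightarrow> 'a set" where
  "functional_kernel h = {x. blinfun_apply h x = 0}"

definition norm_attainment_set :: "('a::real_normed_vector \<Rightarrow>\<^sub>L real) \<Rightarrow> 'a set" where
  "norm_attainment_set h = {x \<in> sphere 0 1. \<bar>blinfun_apply h x\<bar> = norm h}"

definition best_approximation ::
    "'b::real_normed_vector \<Rightarrow> 'b set \<Rightarrow> 'b \<Rightarrow> bool" where
  "best_approximation x V y \<longleftrightarrow> y \<in> V \<and> (\<forall>z \<in> V. norm (x - y) \<le> norm (x - z))"

end

theory Submission
  imports Defs
begin

text \<open>
  Put \<open>h = f - (\<Sum>i=1..n. \<alpha> i *\<^sub>R g i)\<close> and let \<open>Z\<close> be the span of the \<open>g i\<close>; since \<open>f \<notin> Z\<close>, \<open>h \<noteq> 0\<close>.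

  If a unit vector \<open>x\<close> lies in all the kernels and \<open>\<bar>h x\<bar> = norm h\<close>, then for each \<open>z \<in> Z\<close>
  evaluation at \<open>x\<close> kills both \<open>z\<close> and \<open>f - h\<close>, so \<open>norm (f - z) \<ge> \<bar>f x\<bar> = \<bar>h x\<bar> = norm h\<close>
  (lemma \<open>best_approximation_if_attained\<close>).

  Conversely, if the sum is a best approximation, then \<open>norm h\<close> is the distance from \<open>h\<close> to \<open>Z\<close>.
  The Hahn--Banach theorem, applied in the dual to the seminorm ``distance to \<open>Z\<close>'', gives
  a functional \<open>\<Phi>\<close> on the dual of norm at most \<open>1\<close> with \<open>\<Phi> = 0\<close> on \<open>Z\<close> and \<open>\<Phi> h = norm h\<close>.
  Reflexivity represents \<open>\<Phi>\<close> by a vector \<open>x\<close>; a second use of Hahn--Banach, in the space itself,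
  shows \<open>norm x \<le> 1\<close>, and \<open>h x = norm h \<noteq> 0\<close> forces \<open>norm x = 1\<close>. Strict convexity makes
  the norming vectors of \<open>h\<close> unique up to sign (lemma \<open>norm_attainment_set_unique\<close>), so the
  intersection is exactly \<open>{x, - x}\<close>.

  Hahn--Banach is derived from Zorn's lemma in a form that involves no partially defined
  functionals: a pointwise minimal sublinear functional is linear.
\<close>

section \<open>Sublinear functionals and the Hahn--Banach theorem\<close>

text \<open>Positive homogeneity is required only as an inequality and only for \<open>t > 0\<close>; equality, and
  \<open>p 0 = 0\<close>, follow by scaling back.\<close>
definition sublinear :: "('a::real_vector \<Rightarrow> real) \<Rightarrow> bool" where
  "sublinear p \<longleftrightarrow> (\<forall>x y. p (x + y) \<le> p x + p y) \<and> (\<forall>x. \<forall>t>0. p (t *\<^sub>R x) \<le> t * p x)"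

lemma sublinear_add: "sublinear p \<Longrightarrow> p (x + y) \<le> p x + p y"
  by (simp add: sublinear_def)

lemma sublinear_zero:
  assumes "sublinear p"
  shows "p 0 = 0"
proof -
  have "p (2 *\<^sub>R 0) \<le> 2 * p 0" "p ((1/2) *\<^sub>R 0) \<le> (1/2) * p 0"
    using assms unfolding sublinear_def by (metis zero_less_numeral, metis half_gt_zero zero_less_one)
  then show ?thesis by simp
qed

lemma sublinear_scale:
  assumes "sublinear p" and "0 \<le> t"
  shows "p (t *\<^sub>R x) = t * p x"
proof (cases "t = 0")
  case True
  then show ?thesis using sublinear_zero[OF assms(1)] by simp
next
  case False
  then have t: "t > 0" using assms by simp
  have 1: "p (t *\<^sub>R x) \<le> t * p x" using assms t by (simp add: sublinear_def)
  have "p ((1/t) *\<^sub>R (t *\<^sub>R x)) \<le> (1/t) * p (t *\<^sub>R x)"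
    using assms(1) t unfolding sublinear_def by (metis zero_less_divide_1_iff)
  then have "p x \<le> p (t *\<^sub>R x) / t" using t by simp
  then have "t * p x \<le> p (t *\<^sub>R x)" using t by (simp add: field_simps)
  with 1 show ?thesis by simp
qed

lemma sublinear_lower:
  assumes "sublinear p"
  shows "- p (- x) \<le> p x"
  using sublinear_add[OF assms, of x "- x"] sublinear_zero[OF assms] by simp

lemma le_cINF_add:
  fixes F :: "'i \<Rightarrow> real" and G :: "'j \<Rightarrow> real"
  assumes "A \<noteq> {}" "B \<noteq> {}" "\<And>i j. i \<in> A \<Longrightarrow> j \<in> B \<Longrightarrow> a \<le> F i + G j"
  shows "a \<le> (INF i\<in>A. F i) + (INF j\<in>B. G j)"
proof -
  have "a - F i \<le> (INF j\<in>B. G j)" if "i \<in> A" for i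
    by (rule cINF_greatest) (use assms that in \<open>auto simp: algebra_simps\<close>)
  then have "a - (INF j\<in>B. G j) \<le> (INF i\<in>A. F i)"
    by (intro cINF_greatest) (use assms in \<open>auto simp: algebra_simps\<close>)
  then show ?thesis by simp
qed

lemma le_mult_cINF:
  fixes F :: "'i \<Rightarrow> real"
  assumes "A \<noteq> {}" "0 < t" "\<And>i. i \<in> A \<Longrightarrow> a \<le> t * F i"
  shows "a \<le> t * (INF i\<in>A. F i)"
proof -
  have "a / t \<le> (INF i\<in>A. F i)"
    by (rule cINF_greatest) (use assms in \<open>auto simp: field_simps\<close>)
  then show ?thesis using assms by (simp add: field_simps)
qed

text \<open>For sublinear \<open>p\<close>, the largest sublinear functional below \<open>p\<close> with value \<open>- p y\<close> at \<open>- y\<close>;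
  it is therefore linear on the line through \<open>y\<close>, where it still agrees with \<open>p\<close> at \<open>y\<close>.\<close>
definition linearize_along :: "'a::real_vector \<Rightarrow> ('a \<Rightarrow> real) \<Rightarrow> 'a \<Rightarrow> real" where
  "linearize_along y p x = (INF t\<in>{0..}. p (x + t *\<^sub>R y) - t * p y)"

lemma linearize_along_le:
  assumes "sublinear p" "0 \<le> t"
  shows "linearize_along y p x \<le> p (x + t *\<^sub>R y) - t * p y"
proof -
  have "- p (- x) \<le> p (x + s *\<^sub>R y) - s * p y" if "0 \<le> s" for s
    using sublinear_add[OF assms(1), of "x + s *\<^sub>R y" "- x"] sublinear_scale[OF assms(1) that, of y]
    by simp
  then have "bdd_below ((\<lambda>s. p (x + s *\<^sub>R y) - s * p y) ` {0..})"
    by (intro bdd_belowI2) auto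
  then show ?thesis
    unfolding linearize_along_def by (rule cINF_lower) (use assms in simp)
qed

lemma linearize_along_below: "sublinear p \<Longrightarrow> linearize_along y p x \<le> p x"
  using linearize_along_le[of p 0 y x] by simp

lemma sublinear_linearize_along:
  assumes p: "sublinear p"
  shows "sublinear (linearize_along y p)"
  unfolding sublinear_def
proof (intro conjI allI impI)
  fix x z
  show "linearize_along y p (x + z) \<le> linearize_along y p x + linearize_along y p z"
    unfolding linearize_along_def[of y p x] linearize_along_def[of y p z]
  proof (rule le_cINF_add)
    fix s t :: real assume st: "s \<in> {0..}" "t \<in> {0..}"
    have "linearize_along y p (x + z) \<le> p ((x + z) + (s + t) *\<^sub>R y) - (s + t) * p y"
      by (rule linearize_along_le[OF p]) (use st in auto)
    also have "(x + z) + (s + t) *\<^sub>R y = (x + s *\<^sub>R y) + (z + t *\<^sub>R y)"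
      by (simp add: algebra_simps)
    also have "p \<dots> \<le> p (x + s *\<^sub>R y) + p (z + t *\<^sub>R y)"
      by (rule sublinear_add[OF p])
    finally show "linearize_along y p (x + z)
        \<le> (p (x + s *\<^sub>R y) - s * p y) + (p (z + t *\<^sub>R y) - t * p y)"
      by (simp add: algebra_simps)
  qed auto
next
  fix x and t :: real assume t: "0 < t"
  show "linearize_along y p (t *\<^sub>R x) \<le> t * linearize_along y p x"
    unfolding linearize_along_def[of y p x]
  proof (rule le_mult_cINF)
    fix s :: real assume s: "s \<in> {0..}"
    have "linearize_along y p (t *\<^sub>R x) \<le> p (t *\<^sub>R x + (t * s) *\<^sub>R y) - (t * s) * p y"
      by (rule linearize_along_le[OF p]) (use s t in auto)
    also have "t *\<^sub>R x + (t * s) *\<^sub>R y = t *\<^sub>R (x + s *\<^sub>R y)"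
      by (simp add: algebra_simps)
    also have "p \<dots> = t * p (x + s *\<^sub>R y)"
      using sublinear_scale[OF p] t by simp
    finally show "linearize_along y p (t *\<^sub>R x) \<le> t * (p (x + s *\<^sub>R y) - s * p y)"
      by (simp add: algebra_simps)
  qed (use t in auto)
qed

text \<open>Minimality forces \<open>q\<close> to equal each \<open>linearize_along y q\<close>, which gives
  \<open>q x + q y \<le> q (x + y)\<close>.\<close>
lemma linear_if_minimal_sublinear:
  assumes q: "sublinear q"
    and minimal: "\<And>r. sublinear r \<Longrightarrow> r \<le> q \<Longrightarrow> r = q"
  shows "linear q"
proof -
  have add: "q (x + y) = q x + q y" for x y
  proof -
    have "linearize_along y q = q"
      by (rule minimal) (auto simp: le_fun_def q sublinear_linearize_along linearize_along_below)
    then have "q x \<le> q (x + y) - q y"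
      using linearize_along_le[OF q, of 1 y x] by simp
    then show ?thesis using sublinear_add[OF q, of x y] by simp
  qed
  have minus: "q (- x) = - q x" for x
    using add[of x "- x"] sublinear_zero[OF q] by simp
  show ?thesis
  proof (rule linearI)
    fix t :: real and x
    show "q (t *\<^sub>R x) = t *\<^sub>R q x"
    proof (cases "0 \<le> t")
      case True
      then show ?thesis using sublinear_scale[OF q] by simp
    next
      case False
      then show ?thesis
        using sublinear_scale[OF q, of "- t" x] minus[of "t *\<^sub>R x"] by simp
    qed
  qed (rule add)
qed

lemma sublinear_INF_chain:
  assumes "C \<noteq> {}" and sub: "\<And>q. q \<in> C \<Longrightarrow> sublinear q"
    and chain: "\<And>q r. q \<in> C \<Longrightarrow> r \<in> C \<Longrightarrow> q \<le> r \<or> r \<le> q"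
    and below: "\<And>q x. q \<in> C \<Longrightarrow> (INF r\<in>C. r x) \<le> q x"
  shows "sublinear (\<lambda>x. INF q\<in>C. q x)"
  unfolding sublinear_def
proof (intro conjI allI impI)
  fix x y
  show "(INF q\<in>C. q (x + y)) \<le> (INF q\<in>C. q x) + (INF q\<in>C. q y)"
  proof (rule le_cINF_add)
    fix q r assume qr: "q \<in> C" "r \<in> C"
    then obtain m where m: "m \<in> C" "m \<le> q" "m \<le> r" using chain by blast
    have "(INF q\<in>C. q (x + y)) \<le> m (x + y)" using below m by blast
    also have "\<dots> \<le> m x + m y" by (rule sublinear_add[OF sub[OF m(1)]])
    also have "\<dots> \<le> q x + r y" using m by (intro add_mono) (auto simp: le_fun_def)
    finally show "(INF q\<in>C. q (x + y)) \<le> q x + r y" .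
  qed (use assms in auto)
next
  fix x and t :: real assume t: "0 < t"
  show "(INF q\<in>C. q (t *\<^sub>R x)) \<le> t * (INF q\<in>C. q x)"
  proof (rule le_mult_cINF)
    fix q assume q: "q \<in> C"
    show "(INF q\<in>C. q (t *\<^sub>R x)) \<le> t * q x"
      using below[OF q, of "t *\<^sub>R x"] sublinear_scale[OF sub[OF q], of t x] t by simp
  qed (use assms t in auto)
qed

lemma ex_linear_below_sublinear:
  fixes p :: "'a::real_vector \<Rightarrow> real"
  assumes p: "sublinear p"
  obtains \<phi> where "linear \<phi>" "\<And>x. \<phi> x \<le> p x"
proof -
  define A where "A = {q. sublinear q \<and> q \<le> p}"
  define P :: "('a \<Rightarrow> real) \<Rightarrow> ('a \<Rightarrow> real) \<Rightarrow> bool" where "P = (\<lambda>q r. r \<le> q)"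
  have po: "partial_order_on A (relation_of P A)"
    unfolding P_def by (rule partial_order_on_relation_ofI) auto
  have "\<exists>m\<in>A. \<forall>q\<in>A. P m q \<longrightarrow> q = m"
  proof (rule predicate_Zorn[OF po])
    fix C assume C: "C \<in> Chains (relation_of P A)"
    have CA: "C \<subseteq> A" and chain: "q \<le> r \<or> r \<le> q" if "q \<in> C" "r \<in> C" for q r
      using C that by (auto simp: Chains_def relation_of_def P_def)
    show "\<exists>u\<in>A. \<forall>q\<in>C. P q u"
    proof (cases "C = {}")
      case True
      then show ?thesis using p by (auto simp: A_def)
    next
      case False
      then obtain q0 where q0: "q0 \<in> C" by blast
      have CA: "q \<in> A" if "q \<in> C" for q using CA that by blast
      have "- p (- x) \<le> q x" if "q \<in> C" for q x
      proof -
        have "q (- x) \<le> p (- x)" using CA[OF that] by (auto simp: A_def le_fun_def)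
        then show ?thesis using sublinear_lower[of q x] CA[OF that] by (auto simp: A_def)
      qed
      then have "bdd_below ((\<lambda>q. q x) ` C)" for x
        by (intro bdd_belowI2) auto
      then have below: "(INF r\<in>C. r x) \<le> q x" if "q \<in> C" for q x
        using that by (intro cINF_lower) auto
      define u where "u = (\<lambda>x. INF q\<in>C. q x)"
      have "sublinear u"
        unfolding u_def
        by (rule sublinear_INF_chain) (use False CA chain below in \<open>auto simp: A_def\<close>)
      moreover have ule: "u \<le> q" if "q \<in> C" for q
        using below that by (auto simp: u_def le_fun_def)
      moreover have "u \<le> p" using ule[OF q0] CA[OF q0] by (auto simp: A_def)
      ultimately show ?thesis by (auto simp: A_def P_def)
    qed
  qed
  then obtain m where m: "m \<in> A" and min: "\<And>q. q \<in> A \<Longrightarrow> q \<le> m \<Longrightarrow> q = m"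
    by (auto simp: P_def)
  have "linear m"
  proof (rule linear_if_minimal_sublinear)
    show "sublinear m" using m by (simp add: A_def)
    show "r = m" if "sublinear r" "r \<le> m" for r
      using that m by (intro min) (auto simp: A_def)
  qed
  moreover have "m x \<le> p x" for x using m by (auto simp: A_def le_fun_def)
  ultimately show thesis by (rule that)
qed

text \<open>Prescribing the value at \<open>y\<close> costs nothing: a linear functional below \<open>linearize_along y p\<close>
  has value at most \<open>- p y\<close> at \<open>- y\<close>, hence exactly \<open>p y\<close> at \<open>y\<close>.\<close>
theorem hahn_banach_sublinear:
  fixes p :: "'a::real_vector \<Rightarrow> real"
  assumes p: "sublinear p"
  obtains \<phi> where "linear \<phi>" "\<And>x. \<phi> x \<le> p x" "\<phi> y = p y"
proof -
  obtain \<phi> where \<phi>: "linear \<phi>" and le: "\<And>x. \<phi> x \<le> linearize_along y p x"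
    using ex_linear_below_sublinear[OF sublinear_linearize_along[OF p]] by blast
  have le_p: "\<phi> x \<le> p x" for x
    using le[of x] linearize_along_below[OF p, of y x] by simp
  have "\<phi> (- y) \<le> - p y"
    using le[of "- y"] linearize_along_le[OF p, of 1 y "- y"] sublinear_zero[OF p] by simp
  then have "\<phi> y = p y"
    using le_p[of y] linear_neg[OF \<phi>, of y] by simp
  with \<phi> le_p show thesis by (rule that)
qed

text \<open>The hypothesis says that the distance from \<open>y\<close> to \<open>Z\<close> is \<open>norm y\<close>. That distance is a
  seminorm in \<open>y\<close> which is bounded by the norm and vanishes on \<open>Z\<close>, so every linear functional
  below it has norm at most one and annihilates \<open>Z\<close>. For \<open>Z = {0}\<close> this is the existence of
  a norming functional.\<close>
lemma norming_functional_annihilating_subspace: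
  fixes y :: "'a::real_normed_vector"
  assumes Z: "subspace Z" and far: "\<And>z. z \<in> Z \<Longrightarrow> norm y \<le> norm (y - z)"
  obtains \<Phi> :: "'a \<Rightarrow>\<^sub>L real" where
    "norm \<Phi> \<le> 1" "\<And>z. z \<in> Z \<Longrightarrow> \<Phi> z = 0" "\<Phi> y = norm y"
proof -
  define p where "p x = (INF z\<in>Z. norm (x - z))" for x
  have ne: "Z \<noteq> {}" using subspace_0[OF Z] by blast
  have p_le: "p x \<le> norm (x - z)" if "z \<in> Z" for x z
    unfolding p_def by (rule cINF_lower) (use that in \<open>auto intro!: bdd_belowI2[of _ 0]\<close>)
  have p: "sublinear p"
    unfolding sublinear_def
  proof (intro conjI allI impI)
    fix x y
    show "p (x + y) \<le> p x + p y"
      unfolding p_def[of x] p_def[of y]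
    proof (rule le_cINF_add[OF ne ne])
      fix w z assume "w \<in> Z" "z \<in> Z"
      then have "p (x + y) \<le> norm ((x + y) - (w + z))" by (intro p_le subspace_add[OF Z])
      also have "(x + y) - (w + z) = (x - w) + (y - z)" by simp
      finally show "p (x + y) \<le> norm (x - w) + norm (y - z)"
        using norm_triangle_ineq[of "x - w" "y - z"] by linarith
    qed
  next
    fix x and t :: real assume t: "0 < t"
    show "p (t *\<^sub>R x) \<le> t * p x"
      unfolding p_def[of x]
    proof (rule le_mult_cINF[OF ne t])
      fix z assume "z \<in> Z"
      then have "p (t *\<^sub>R x) \<le> norm (t *\<^sub>R x - t *\<^sub>R z)" by (intro p_le subspace_scale[OF Z])
      also have "\<dots> = t * norm (x - z)"
        using t by (simp flip: scaleR_diff_right)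
      finally show "p (t *\<^sub>R x) \<le> t * norm (x - z)" .
    qed
  qed
  obtain \<phi> where \<phi>: "linear \<phi>" and le: "\<And>x. \<phi> x \<le> p x" and y: "\<phi> y = p y"
    using hahn_banach_sublinear[OF p] by blast
  have "\<bar>\<phi> x\<bar> \<le> norm x" for x
    using le[of x] le[of "- x"] p_le[OF subspace_0[OF Z], of x] p_le[OF subspace_0[OF Z], of "- x"]
      linear_neg[OF \<phi>, of x] by auto
  then have bl: "bounded_linear \<phi>" and bound: "\<And>x. norm (\<phi> x) \<le> norm x"
    using \<phi> by (auto intro!: bounded_linear_intro[where K = 1] simp: linear_add linear_scale)
  show thesis
  proof (rule that[of "Blinfun \<phi>"])
    show "norm (Blinfun \<phi>) \<le> 1"
      by (rule norm_blinfun_bound) (use bound bl in \<open>auto simp: bounded_linear_Blinfun_apply\<close>)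
    show "Blinfun \<phi> z = 0" if "z \<in> Z" for z
      using le[of z] le[of "- z"] p_le[OF that, of z] p_le[OF subspace_neg[OF Z that], of "- z"]
        linear_neg[OF \<phi>, of z] by (simp add: bounded_linear_Blinfun_apply[OF bl])
    have "norm y \<le> p y"
      unfolding p_def by (rule cINF_greatest[OF ne far])
    then show "Blinfun \<phi> y = norm y"
      using p_le[OF subspace_0[OF Z], of y] y by (simp add: bounded_linear_Blinfun_apply[OF bl])
  qed
qed

section \<open>Norm attainment and best approximation in the dual\<close>

text \<open>The Hahn--Banach theorem is what makes the representing vector no longer than \<open>\<Phi>\<close>.\<close>
lemma reflexive_space_representing_vector:
  fixes \<Phi> :: "('a::real_normed_vector \<Rightarrow>\<^sub>L real) \<Rightarrow>\<^sub>L real"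
  assumes "reflexive_space TYPE('a)"
  obtains x :: 'a where "\<And>h. \<Phi> h = h x" "norm x \<le> norm \<Phi>"
proof -
  obtain x :: 'a where x: "\<And>h. \<Phi> h = h x"
    using assms unfolding reflexive_space_def by blast
  obtain k :: "'a \<Rightarrow>\<^sub>L real" where k: "norm k \<le> 1" "k x = norm x"
    using norming_functional_annihilating_subspace[of "{0}" x] subspace_single_0 by auto
  have "norm x \<le> norm \<Phi> * norm k"
    using norm_blinfun[of \<Phi> k] x[of k] k by simp
  also have "\<dots> \<le> norm \<Phi>"
    using k mult_left_mono[of "norm k" 1 "norm \<Phi>"] by simp
  finally show thesis using x that by blast
qed

lemma norm_ge_1_if_norming:
  fixes h :: "'a::real_normed_vector \<Rightarrow>\<^sub>L real"
  assumes "h \<noteq> 0" and "h x = norm h"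
  shows "1 \<le> norm x"
proof -
  have "norm h * 1 \<le> norm h * norm x" using norm_blinfun[of h x] assms(2) by simp
  then show ?thesis by (rule mult_left_le_imp_le) (use assms(1) in simp)
qed

lemma norming_vector_unique:
  fixes h :: "'a::real_normed_vector \<Rightarrow>\<^sub>L real"
  assumes sc: "strictly_convex_space TYPE('a)" and h: "h \<noteq> 0"
    and x: "norm x = 1" "h x = norm h" and y: "norm y = 1" "h y = norm h"
  shows "x = y"
proof (rule ccontr)
  assume ne: "x \<noteq> y"
  define m where "m = midpoint x y"
  have hm: "h m = norm h"
    using x y by (simp add: m_def midpoint_def blinfun.scaleR_right blinfun.add_right)
  have "1 \<le> norm m" using h hm by (rule norm_ge_1_if_norming)
  moreover have "norm m \<le> 1"
    using norm_triangle_ineq[of x y] x y by (simp add: m_def midpoint_def)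
  ultimately have "m extreme_point_of cball 0 1"
    using sc by (auto simp: strictly_convex_space_def)
  moreover have "m \<in> open_segment x y"
    using ne by (simp add: m_def midpoint_in_open_segment)
  ultimately show False
    using x y by (auto simp: extreme_point_of_def)
qed

lemma norm_attainment_set_unique:
  fixes h :: "'a::real_normed_vector \<Rightarrow>\<^sub>L real"
  assumes sc: "strictly_convex_space TYPE('a)" and h: "h \<noteq> 0"
    and x: "x \<in> norm_attainment_set h" and y: "y \<in> norm_attainment_set h"
  shows "y = x \<or> y = - x"
proof -
  have signed: "\<exists>s\<in>{v, - v}. norm s = 1 \<and> h s = norm h" if "v \<in> norm_attainment_set h" for v
    using that by (auto simp: norm_attainment_set_def blinfun.minus_right abs_if split: if_splits)
  obtain s t where "s \<in> {x, - x}" "norm s = 1" "h s = norm h"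
      and "t \<in> {y, - y}" "norm t = 1" "h t = norm h"
    using signed[OF x] signed[OF y] by blast
  then have "s = t" and "s \<in> {x, - x}" "t \<in> {y, - y}"
    using norming_vector_unique[OF sc h] by blast+
  then show ?thesis by auto
qed

lemma eval_span_eq_0:
  fixes G :: "('a::real_normed_vector \<Rightarrow>\<^sub>L real) set"
  assumes "\<And>g. g \<in> G \<Longrightarrow> g x = 0" and "z \<in> span G"
  shows "z x = 0"
  using assms(2)
  by (induction rule: span_induct_alt)
    (auto simp: assms(1) blinfun.add_left blinfun.scaleR_left)

lemma best_approximation_if_attained:
  fixes f :: "'a::real_normed_vector \<Rightarrow>\<^sub>L real"
    and G :: "('a \<Rightarrow>\<^sub>L real) set"
  assumes v: "v \<in> span G" and ker: "\<And>g. g \<in> G \<Longrightarrow> g x = 0"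
    and x: "x \<in> norm_attainment_set (f - v)"
  shows "best_approximation f (span G) v"
  unfolding best_approximation_def
proof (intro conjI ballI v)
  fix z assume z: "z \<in> span G"
  have "norm (f - v) = \<bar>(f - v) x\<bar>" using x by (simp add: norm_attainment_set_def)
  also have "\<dots> = \<bar>(f - z) x\<bar>"
    using eval_span_eq_0[of G x v, OF ker v] eval_span_eq_0[of G x z, OF ker z]
    by (simp add: blinfun.diff_left)
  also have "\<dots> \<le> norm (f - z)"
    using norm_blinfun[of "f - z" x] x by (simp add: norm_attainment_set_def)
  finally show "norm (f - v) \<le> norm (f - z)" .
qed

lemma attained_if_best_approximation:
  fixes f :: "'a::real_normed_vector \<Rightarrow>\<^sub>L real"
    and G :: "('a \<Rightarrow>\<^sub>L real) set"
  assumes refl: "reflexive_space TYPE('a)" and f: "f \<notin> span G"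
    and best: "best_approximation f (span G) v"
  obtains x where "x \<in> norm_attainment_set (f - v)" "\<And>g. g \<in> G \<Longrightarrow> g x = 0"
proof -
  have v: "v \<in> span G" using best by (simp add: best_approximation_def)
  have h: "f - v \<noteq> 0" using f v by auto
  have far: "norm (f - v) \<le> norm ((f - v) - z)" if "z \<in> span G" for z
  proof -
    have "v + z \<in> span G" using v that by (rule span_add)
    then show ?thesis using best by (simp add: best_approximation_def diff_diff_eq)
  qed
  obtain \<Phi> :: "('a \<Rightarrow>\<^sub>L real) \<Rightarrow>\<^sub>L real" where \<Phi>: "norm \<Phi> \<le> 1"
      "\<And>z. z \<in> span G \<Longrightarrow> \<Phi> z = 0" "\<Phi> (f - v) = norm (f - v)"
    using norming_functional_annihilating_subspace[OF subspace_span far] by blast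
  obtain x :: 'a where x: "\<And>k. \<Phi> k = k x" "norm x \<le> norm \<Phi>"
    using reflexive_space_representing_vector[OF refl] by blast
  have hx: "(f - v) x = norm (f - v)" using \<Phi>(3) x(1) by simp
  have "1 \<le> norm x" using h hx by (rule norm_ge_1_if_norming)
  then have "norm x = 1" using x(2) \<Phi>(1) by simp
  then have "x \<in> norm_attainment_set (f - v)"
    using hx by (simp add: norm_attainment_set_def)
  moreover have "g x = 0" if "g \<in> G" for g
    using \<Phi>(2)[OF span_base[OF that]] x(1) by simp
  ultimately show thesis by (rule that)
qed

theorem theorem3p5:
  fixes f :: "'a::banach \<Rightarrow>\<^sub>L real"
    and g :: "nat \<Rightarrow> ('a \<Rightarrow>\<^sub>L real)"
    and \<alpha> :: "nat \<Rightarrow> real"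
    and n :: nat
  assumes "reflexive_space TYPE('a)"
    and "strictly_convex_space TYPE('a)"
    and "inj_on g {1..n}" and "independent (g ` {1..n})"
    and "f \<notin> span (g ` {1..n})"
  shows "best_approximation f (span (g ` {1..n})) (\<Sum>i=1..n. \<alpha> i *\<^sub>R g i) \<longleftrightarrow>
    (\<exists>x0 \<in> sphere 0 1.
       (\<Inter>i\<in>{1..n}. functional_kernel (g i)) \<inter>
         norm_attainment_set (f - (\<Sum>i=1..n. \<alpha> i *\<^sub>R g i)) = {x0, - x0})"
    (is "?best \<longleftrightarrow> (\<exists>x0 \<in> sphere 0 1. ?K \<inter> norm_attainment_set (f - ?v) = {x0, - x0})")
proof -
  have v: "?v \<in> span (g ` {1..n})"
    by (intro span_sum span_scale span_base) auto
  then have h: "f - ?v \<noteq> 0" using assms(5) by auto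
  show ?thesis
  proof
    assume ?best
    then obtain x where x: "x \<in> norm_attainment_set (f - ?v)"
        and ker: "\<And>k. k \<in> g ` {1..n} \<Longrightarrow> k x = 0"
      using attained_if_best_approximation[OF assms(1,5)] by blast
    have "x \<in> ?K" "- x \<in> ?K"
      using ker by (auto simp: functional_kernel_def blinfun.minus_right)
    moreover have "- x \<in> norm_attainment_set (f - ?v)"
      using x by (simp add: norm_attainment_set_def blinfun.minus_right)
    ultimately have "?K \<inter> norm_attainment_set (f - ?v) = {x, - x}"
      using x norm_attainment_set_unique[OF assms(2) h x] by blast
    moreover have "x \<in> sphere 0 1" using x by (simp add: norm_attainment_set_def)
    ultimately show "\<exists>x0 \<in> sphere 0 1. ?K \<inter> norm_attainment_set (f - ?v) = {x0, - x0}" by blast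
  next
    assume "\<exists>x0 \<in> sphere 0 1. ?K \<inter> norm_attainment_set (f - ?v) = {x0, - x0}"
    then obtain x0 where "x0 \<in> ?K" "x0 \<in> norm_attainment_set (f - ?v)" by blast
    then show ?best
      by (intro best_approximation_if_attained[OF v, of x0]) (auto simp: functional_kernel_def)
  qed
qed

end
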